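(* Let $X$ be a path metric space. If $X$ is uncompressed, then $K_3(X)$ contains the interior of $K_3(\mathbb{R}^2)$.
   Context: $\mathbb{R}_+=[0,\infty)$. For a metric space $(X,d)$, $K_3(X)$ is the set of all $(a,b,c)\in\mathbb{R}_+^3$ for which there exist points $x,y,z\in X$ with $d(x,y)=a$, $d(y,z)=b$, $d(z,x)=c$. Thus $K_3(\mathbb{R}^2)=\{(a,b,c)\in\mathbb{R}_+^3: a\le b+c,\ b\le a+c,\ c\le a+b\}$; its interior is taken in $\mathbb{R}^3$. A path metric space is a metric space $X$ such that for all $x,y\in X$, $d(x,y)$ equals the infimum of the lengths of continuous paths in $X$ connecting $x$ to $y$. For $\epsilon\ge 0$, a continuous curve $\gamma:[a,b]\to X$ is an $\epsilon$-geodesic if $\mathrm{length}(\gamma)\le d(\gamma(a),\gamma(b))+\epsilon$. Tripods: let $x,y,z,o\in X$ and let $\mu$ be an $\epsilon$-geodesic connecting $x$ to $y$ and passing through $o$, such that $d(z,o)\le d(z,w)+\epsilon$ for every $w\in\mu$ (i.e. $o$ is an $\epsilon$-nearest-point projection of $z$ to $\mu$). Then $\mu$ is the concatenation $\alpha\cup\beta$ of $\epsilon$-geodesics $\alpha,\beta$ connecting $x$, $y$ respectively to $o$. Let $\gamma$ be an $\epsilon$-geodesic connecting $z$ to $o$. Then $T=\alpha\cup\beta\cup\gamma$ is called a tripod with vertices $x,y,z$, legs $\alpha,\beta,\gamma$ and center $o$. If $\alpha,\beta,\gamma$ all have length at least $R$, then $T$ is called an $(R,\epsilon)$-tripod. $X$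 is $(R,\epsilon)$-compressed if it contains no $(R,\epsilon)$-tripods. $X$ is uncompressed if it is not $(R,\epsilon)$-compressed for any $R<\infty$, $\epsilon>0$; equivalently, there is a sequence of $(R_i,\epsilon_i)$-tripods in $X$ with $\lim_i R_i=\infty$ and $\lim_i\epsilon_i=0$. *)

theory Defs
  imports "HOL-Analysis.Analysis"
begin

text \<open>
  A metric space is given by a subset \<open>X\<close> of a type of class \<open>metric_space\<close>, with the
  restricted distance. A curve is a function on \<open>real\<close> together with the endpoints \<open>a \<le> b\<close>
  of its parameter interval; its values outside \<open>{a..b}\<close> are irrelevant.
\<close>

definition curve_in :: "'a::metric_space set \<Rightarrow> (real \<Rightarrow> 'a) \<Rightarrow> real \<Rightarrow> real \<Rightarrow> bool" where
  "curve_in X \<gamma> a b \<longleftrightarrow> a \<le> b \<and> continuous_on {a..b} \<gamma> \<and> \<gamma> ` {a..b} \<subseteq> X"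

text \<open>Supremum over partitions \<open>a = t 0 \<le> \<dots> \<le> t n = b\<close>; it may be infinite.\<close>

definition curve_length :: "(real \<Rightarrow> 'a::metric_space) \<Rightarrow> real \<Rightarrow> real \<Rightarrow> ennreal" where
  "curve_length \<gamma> a b =
     (SUP (n, t) \<in> {(n :: nat, t :: nat \<Rightarrow> real). mono_on {..n} t \<and> t 0 = a \<and> t n = b}.
        \<Sum>i<n. ennreal (dist (\<gamma> (t i)) (\<gamma> (t (Suc i)))))"

text \<open>The infimum over the empty set is \<open>\<infinity>\<close>, so the equality also forces \<open>X\<close> to be path-connected.\<close>

definition path_metric_space :: "'a::metric_space set \<Rightarrow> bool" where
  "path_metric_space X \<longleftrightarrow>
     (\<forall>x\<in>X. \<forall>y\<in>X. ennreal (dist x y) =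
        (INF (\<gamma>, a, b) \<in> {(\<gamma>, a, b). curve_in X \<gamma> a b \<and> \<gamma> a = x \<and> \<gamma> b = y}. curve_length \<gamma> a b))"

definition eps_geodesic ::
  "'a::metric_space set \<Rightarrow> real \<Rightarrow> (real \<Rightarrow> 'a) \<Rightarrow> real \<Rightarrow> real \<Rightarrow> bool" where
  "eps_geodesic X \<epsilon> \<gamma> a b \<longleftrightarrow>
     0 \<le> \<epsilon> \<and> curve_in X \<gamma> a b \<and> curve_length \<gamma> a b \<le> ennreal (dist (\<gamma> a) (\<gamma> b) + \<epsilon>)"

text \<open>
  The tripod with vertices \<open>x\<close>, \<open>y\<close>, \<open>z\<close> and center \<open>p = \<mu> s\<close>. Its legs are the restrictions
  of \<open>\<mu>\<close> to \<open>{a..s}\<close> (joining \<open>x\<close> to \<open>p\<close>) and to \<open>{s..b}\<close> (joining \<open>p\<close> to \<open>y\<close>), which are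
  \<open>\<epsilon>\<close>-geodesics because \<open>\<mu>\<close> is one, and the curve \<open>\<gamma>\<close> on \<open>{c..d}\<close>.
\<close>

definition tripod ::
  "'a::metric_space set \<Rightarrow> real \<Rightarrow> 'a \<Rightarrow> 'a \<Rightarrow> 'a \<Rightarrow> 'a \<Rightarrow>
   (real \<Rightarrow> 'a) \<Rightarrow> real \<Rightarrow> real \<Rightarrow> real \<Rightarrow> (real \<Rightarrow> 'a) \<Rightarrow> real \<Rightarrow> real \<Rightarrow> bool" where
  "tripod X \<epsilon> x y z p \<mu> a s b \<gamma> c d \<longleftrightarrow>
     eps_geodesic X \<epsilon> \<mu> a b \<and> \<mu> a = x \<and> \<mu> b = y \<and>
     s \<in> {a..b} \<and> \<mu> s = p \<and> (\<forall>w \<in> \<mu> ` {a..b}. dist z p \<le> dist z w + \<epsilon>) \<and>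
     eps_geodesic X \<epsilon> \<gamma> c d \<and> \<gamma> c = z \<and> \<gamma> d = p"

definition R_eps_tripod ::
  "'a::metric_space set \<Rightarrow> real \<Rightarrow> real \<Rightarrow> 'a \<Rightarrow> 'a \<Rightarrow> 'a \<Rightarrow> 'a \<Rightarrow>
   (real \<Rightarrow> 'a) \<Rightarrow> real \<Rightarrow> real \<Rightarrow> real \<Rightarrow> (real \<Rightarrow> 'a) \<Rightarrow> real \<Rightarrow> real \<Rightarrow> bool" where
  "R_eps_tripod X R \<epsilon> x y z p \<mu> a s b \<gamma> c d \<longleftrightarrow>
     tripod X \<epsilon> x y z p \<mu> a s b \<gamma> c d \<and>
     ennreal R \<le> curve_length \<mu> a s \<and>
     ennreal R \<le> curve_length \<mu> s b \<and>
     ennreal R \<le> curve_length \<gamma> c d"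

definition compressed :: "'a::metric_space set \<Rightarrow> real \<Rightarrow> real \<Rightarrow> bool" where
  "compressed X R \<epsilon> \<longleftrightarrow> \<not> (\<exists>x y z p \<mu> a s b \<gamma> c d. R_eps_tripod X R \<epsilon> x y z p \<mu> a s b \<gamma> c d)"

definition uncompressed :: "'a::metric_space set \<Rightarrow> bool" where
  "uncompressed X \<longleftrightarrow> (\<forall>R. \<forall>\<epsilon>>0. \<not> compressed X R \<epsilon>)"

definition K3 :: "'a::metric_space set \<Rightarrow> (real \<times> real \<times> real) set" where
  "K3 X = {(a, b, c). \<exists>x\<in>X. \<exists>y\<in>X. \<exists>z\<in>X. dist x y = a \<and> dist y z = b \<and> dist z x = c}"

end

theory Submission imports Defs begin

text \<open>
  On a tripod with long legs let \<open>P\<close>, \<open>Q\<close> vary on the almost geodesic \<open>\<mu>\<close> and \<open>Z\<close> on the leg \<open>\<gamma>\<close>,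
  and suppose that \<open>Q\<close> follows \<open>P\<close> at distance \<open>a\<close>. With \<open>Z\<close> at the center, \<open>(d(Q,Z), d(Z,P))\<close> runs,
  as \<open>P\<close> moves along \<open>\<mu>\<close>, approximately along the boundary of the half strip
  \<open>{(b,c). \<bar>b - c\<bar> \<le> a \<le> b + c}\<close>, which is the slice of \<open>K\<^sub>3(\<real>\<^sup>2)\<close> at \<open>a\<close>. When \<open>Z\<close> or \<open>P\<close> is far
  from the center, these two distances are large, because the center is an almost nearest point of
  \<open>\<mu>\<close>. So the map covers every compact part of the interior of the half strip with degree one. The
  degree argument is carried out by the Poincare--Miranda theorem on a box of parameters of \<open>P\<close>, \<open>Q\<close>, \<open>Z\<close>.
\<close>

section \<open>Zeros of continuous maps on boxes\<close>

text \<open>A Brouwer fixed point of \<open>x - f x\<close> clamped to the box is a zero of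
  \<open>f\<close>: a coordinate changed by the clamping would lie on a face where the sign
  condition excludes such a change.\<close>

lemma poincare_miranda:
  fixes f :: "'a::euclidean_space \<Rightarrow> 'a"
  assumes le: "\<And>i. i \<in> Basis \<Longrightarrow> a \<bullet> i \<le> b \<bullet> i"
    and cont: "continuous_on (cbox a b) f"
    and lower: "\<And>x i. x \<in> cbox a b \<Longrightarrow> i \<in> Basis \<Longrightarrow> x \<bullet> i = a \<bullet> i \<Longrightarrow> f x \<bullet> i \<le> 0"
    and upper: "\<And>x i. x \<in> cbox a b \<Longrightarrow> i \<in> Basis \<Longrightarrow> x \<bullet> i = b \<bullet> i \<Longrightarrow> 0 \<le> f x \<bullet> i"
  obtains x where "x \<in> cbox a b" "f x = 0"
proof -
  define F where "F x = clamp a b (x - f x)" for x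
  have ne: "cbox a b \<noteq> {}"
    using le by (simp add: box_ne_empty)
  have contF: "continuous_on (cbox a b) F"
  proof -
    have "continuous_on UNIV (clamp a b)"
      by (intro clamp_continuous_on[where f = "\<lambda>x. x"] continuous_on_id)
    moreover have "continuous_on (cbox a b) (\<lambda>x. x - f x)"
      by (intro continuous_intros cont)
    ultimately show ?thesis
      unfolding F_def using continuous_on_compose2 by blast
  qed
  have "F \<in> cbox a b \<rightarrow> cbox a b"
    unfolding F_def using clamp_in_interval[OF le] by blast
  then obtain x where x: "x \<in> cbox a b" "F x = x"
    using brouwer[OF compact_cbox convex_box(1) ne contF] by blast
  have zero: "f x \<bullet> i = 0" if i: "i \<in> Basis" for i
  proof -
    define u where "u = x \<bullet> i - f x \<bullet> i"
    have "F x \<bullet> i = (if u < a \<bullet> i then a \<bullet> i else if u \<le> b \<bullet> i then u else b \<bullet> i)"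
      using i le by (auto simp: F_def clamp_def u_def inner_diff_left)
    then consider "x \<bullet> i = a \<bullet> i" "u < a \<bullet> i" | "x \<bullet> i = u" | "x \<bullet> i = b \<bullet> i" "b \<bullet> i < u"
      unfolding x(2) by argo
    then show ?thesis
      using lower[OF x(1) i] upper[OF x(1) i] unfolding u_def by cases linarith+
  qed
  have "f x = 0"
    by (rule euclidean_eqI) (simp add: zero)
  with x(1) show thesis by (rule that)
qed

lemma poincare_miranda_3:
  fixes f g h :: "real \<Rightarrow> real \<Rightarrow> real \<Rightarrow> real"
  assumes "a\<^sub>1 \<le> b\<^sub>1" "a\<^sub>2 \<le> b\<^sub>2" "a\<^sub>3 \<le> b\<^sub>3"
    and "continuous_on ({a\<^sub>1..b\<^sub>1} \<times> {a\<^sub>2..b\<^sub>2} \<times> {a\<^sub>3..b\<^sub>3}) (\<lambda>(r, s, t). f r s t)"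
    and "continuous_on ({a\<^sub>1..b\<^sub>1} \<times> {a\<^sub>2..b\<^sub>2} \<times> {a\<^sub>3..b\<^sub>3}) (\<lambda>(r, s, t). g r s t)"
    and "continuous_on ({a\<^sub>1..b\<^sub>1} \<times> {a\<^sub>2..b\<^sub>2} \<times> {a\<^sub>3..b\<^sub>3}) (\<lambda>(r, s, t). h r s t)"
    and "\<And>s t. s \<in> {a\<^sub>2..b\<^sub>2} \<Longrightarrow> t \<in> {a\<^sub>3..b\<^sub>3} \<Longrightarrow> f a\<^sub>1 s t \<le> 0 \<and> 0 \<le> f b\<^sub>1 s t"
    and "\<And>r t. r \<in> {a\<^sub>1..b\<^sub>1} \<Longrightarrow> t \<in> {a\<^sub>3..b\<^sub>3} \<Longrightarrow> g r a\<^sub>2 t \<le> 0 \<and> 0 \<le> g r b\<^sub>2 t"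
    and "\<And>r s. r \<in> {a\<^sub>1..b\<^sub>1} \<Longrightarrow> s \<in> {a\<^sub>2..b\<^sub>2} \<Longrightarrow> h r s a\<^sub>3 \<le> 0 \<and> 0 \<le> h r s b\<^sub>3"
  obtains r s t where "r \<in> {a\<^sub>1..b\<^sub>1}" "s \<in> {a\<^sub>2..b\<^sub>2}" "t \<in> {a\<^sub>3..b\<^sub>3}"
    "f r s t = 0" "g r s t = 0" "h r s t = 0"
proof -
  define F where "F = (\<lambda>(r, s, t). (f r s t, g r s t, h r s t))"
  have box: "cbox (a\<^sub>1, a\<^sub>2, a\<^sub>3) (b\<^sub>1, b\<^sub>2, b\<^sub>3) = {a\<^sub>1..b\<^sub>1} \<times> {a\<^sub>2..b\<^sub>2} \<times> {a\<^sub>3..b\<^sub>3}"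
    by (simp add: cbox_Pair_eq)
  have basis: "(Basis :: (real \<times> real \<times> real) set) = {(1, 0, 0), (0, 1, 0), (0, 0, 1)}"
    by (auto simp: Basis_prod_def zero_prod_def)
  have F_eq: "F = (\<lambda>x. ((\<lambda>(r, s, t). f r s t) x, (\<lambda>(r, s, t). g r s t) x, (\<lambda>(r, s, t). h r s t) x))"
    by (auto simp: F_def)
  have cont: "continuous_on (cbox (a\<^sub>1, a\<^sub>2, a\<^sub>3) (b\<^sub>1, b\<^sub>2, b\<^sub>3)) F"
    unfolding box F_eq by (intro continuous_on_Pair assms(4-6))
  obtain x where "x \<in> cbox (a\<^sub>1, a\<^sub>2, a\<^sub>3) (b\<^sub>1, b\<^sub>2, b\<^sub>3)" "F x = 0"
  proof (rule poincare_miranda[OF _ cont])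
    fix i :: "real \<times> real \<times> real" assume "i \<in> Basis"
    then show "(a\<^sub>1, a\<^sub>2, a\<^sub>3) \<bullet> i \<le> (b\<^sub>1, b\<^sub>2, b\<^sub>3) \<bullet> i"
      using assms(1-3) by (auto simp: basis)
  qed (use assms(7-9) in \<open>auto simp: box basis F_def\<close>)
  then show thesis
    by (intro that[of "fst x" "fst (snd x)" "snd (snd x)"])
       (auto simp: box F_def zero_prod_def split: prod.splits)
qed

section \<open>Lengths of curves and almost geodesics\<close>

lemma dist_le_curve_length:
  assumes "a \<le> b"
  shows "ennreal (dist (\<gamma> a) (\<gamma> b)) \<le> curve_length \<gamma> a b"
proof -
  define t where "t i = (if i = 0 then a else b)" for i :: nat
  have "(1, t) \<in> {(n, t). mono_on {..n} t \<and> t 0 = a \<and> t n = b}"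
    using assms by (auto simp: t_def mono_on_def)
  from SUP_upper[OF this, of "\<lambda>(n, t). \<Sum>i<n. ennreal (dist (\<gamma> (t i)) (\<gamma> (t (Suc i))))"]
  show ?thesis
    by (simp add: curve_length_def t_def)
qed

text \<open>A partition of \<open>{a..s}\<close> followed by one of \<open>{s..b}\<close> partitions
  \<open>{a..b}\<close>, and their sums add up.\<close>

lemma curve_length_superadditive:
  assumes "a \<le> s" "s \<le> b"
  shows "curve_length \<gamma> a s + curve_length \<gamma> s b \<le> curve_length \<gamma> a b"
proof -
  define P where "P a b = {(n :: nat, t :: nat \<Rightarrow> real). mono_on {..n} t \<and> t 0 = a \<and> t n = b}" for a b
  define S where "S = (\<lambda>(n, t). \<Sum>i<n. ennreal (dist (\<gamma> (t i)) (\<gamma> (t (Suc i)))))"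
  have len: "curve_length \<gamma> a b = (SUP p \<in> P a b. S p)" for a b
    by (simp add: curve_length_def P_def S_def)
  have ne: "P a b \<noteq> {}" if "a \<le> b" for a b
  proof -
    have "(1, \<lambda>i. if i = 0 then a else b) \<in> P a b"
      using that by (auto simp: P_def mono_on_def)
    then show ?thesis by blast
  qed
  have le: "S p + S q \<le> curve_length \<gamma> a b" if p: "p \<in> P a s" and q: "q \<in> P s b" for p q
  proof -
    obtain n t m u where pq: "p = (n, t)" "q = (m, u)" by (metis surj_pair)
    have t: "mono_on {..n} t" "t 0 = a" "t n = s" and u: "mono_on {..m} u" "u 0 = s" "u m = b"
      using p q by (auto simp: P_def pq)
    \<comment> \<open>Index \<open>n\<close> belongs to both pieces, since
      \<open>t n = s = u 0\<close>.\<close>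
    define v where "v i = (if i \<le> n then t i else u (i - n))" for i
    have "v i \<le> v j" if "i \<le> j" "j \<le> n + m" for i j
    proof -
      have ts: "t i \<le> s" if "i \<le> n"
        using monotone_onD[OF t(1), of i n] that t(3) by simp
      have su: "s \<le> u (j - n)"
        using monotone_onD[OF u(1), of 0 "j - n"] that(2) u(2) by simp
      consider "j \<le> n" | "i \<le> n" "n < j" | "n < i" by linarith
      then show ?thesis
      proof cases
        case 1
        then show ?thesis
          using that monotone_onD[OF t(1), of i j] by (simp add: v_def)
      next
        case 2
        then show ?thesis
          using ts su by (simp add: v_def)
      next
        case 3
        then show ?thesis
          using that monotone_onD[OF u(1), of "i - n" "j - n"] by (simp add: v_def)
      qed
    qed
    moreover have "v 0 = a" "v (n + m) = b"
      using t u by (auto simp: v_def)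
    ultimately have v: "(n + m, v) \<in> P a b"
      by (auto simp: P_def intro!: monotone_onI)
    have v2: "v (n + i) = u i" for i
      using t(3) u(2) by (cases i) (auto simp: v_def)
    have split: "(\<Sum>i<n + m. f i) = (\<Sum>i<n. f i) + (\<Sum>i<m. f (n + i))" for m and f :: "nat \<Rightarrow> ennreal"
      by (induction m) (simp_all add: add.assoc)
    have "S (n + m, v) = (\<Sum>i<n. ennreal (dist (\<gamma> (v i)) (\<gamma> (v (Suc i)))))
        + (\<Sum>i<m. ennreal (dist (\<gamma> (v (n + i))) (\<gamma> (v (Suc (n + i))))))"
      by (simp only: S_def prod.case split)
    also have "(\<Sum>i<n. ennreal (dist (\<gamma> (v i)) (\<gamma> (v (Suc i))))) = S p"
      by (auto simp: S_def pq v_def intro!: sum.cong)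
    also have "(\<Sum>i<m. ennreal (dist (\<gamma> (v (n + i))) (\<gamma> (v (Suc (n + i)))))) = S q"
      by (simp only: v2 S_def pq prod.case flip: add_Suc_right)
    finally show ?thesis
      using SUP_upper[OF v, of S] by (simp add: len)
  qed
  have "curve_length \<gamma> a s + S q \<le> curve_length \<gamma> a b" if "q \<in> P s b" for q
    unfolding len[of a s] using assms ne[of a s] le[OF _ that]
    by (subst ennreal_SUP_add_left[symmetric]) (auto intro: SUP_least)
  then show ?thesis
    unfolding len[of s b] using assms ne[of s b]
    by (subst ennreal_SUP_add_right) (auto intro: SUP_least)
qed

text \<open>The outer pieces are at least as long as their chords. Cancelling these, with total
  \<open>D\<close>, leaves an excess of at most \<open>\<epsilon>\<close> for the middle
  piece.\<close>

lemma eps_geodesic_subsegment: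
  assumes geo: "eps_geodesic X \<epsilon> \<mu> a b" and "a \<le> r" "r \<le> t" "t \<le> b"
  shows "eps_geodesic X \<epsilon> \<mu> r t"
proof -
  define D where "D = dist (\<mu> a) (\<mu> r) + dist (\<mu> t) (\<mu> b)"
  have "ennreal D + curve_length \<mu> r t
      = ennreal (dist (\<mu> a) (\<mu> r)) + (curve_length \<mu> r t + ennreal (dist (\<mu> t) (\<mu> b)))"
    by (simp add: D_def ac_simps)
  also have "\<dots> \<le> curve_length \<mu> a r + (curve_length \<mu> r t + curve_length \<mu> t b)"
    using assms by (intro add_mono dist_le_curve_length) auto
  also have "\<dots> \<le> curve_length \<mu> a r + curve_length \<mu> r b"
    using assms by (intro add_mono curve_length_superadditive) auto
  also have "\<dots> \<le> curve_length \<mu> a b"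
    using assms by (intro curve_length_superadditive) auto
  also have "\<dots> \<le> ennreal (dist (\<mu> a) (\<mu> b) + \<epsilon>)"
    using geo unfolding eps_geodesic_def by blast
  also have "\<dots> \<le> ennreal (D + (dist (\<mu> r) (\<mu> t) + \<epsilon>))"
    using dist_triangle[of "\<mu> a" "\<mu> b" "\<mu> r"] dist_triangle[of "\<mu> r" "\<mu> b" "\<mu> t"]
    by (intro ennreal_leI) (simp add: D_def)
  also have "\<dots> = ennreal D + ennreal (dist (\<mu> r) (\<mu> t) + \<epsilon>)"
    using geo by (intro ennreal_plus) (auto simp: D_def eps_geodesic_def)
  finally have "curve_length \<mu> r t \<le> ennreal (dist (\<mu> r) (\<mu> t) + \<epsilon>)"
    by (simp add: ennreal_add_left_cancel_le)
  moreover have "curve_in X \<mu> r t"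
    using assms by (auto simp: eps_geodesic_def curve_in_def intro: continuous_on_subset)
  ultimately show ?thesis
    using geo unfolding eps_geodesic_def by blast
qed

lemma eps_geodesic_dist_add_le:
  assumes geo: "eps_geodesic X \<epsilon> \<mu> a b" and "a \<le> r" "r \<le> s" "s \<le> t" "t \<le> b"
  shows "dist (\<mu> r) (\<mu> s) + dist (\<mu> s) (\<mu> t) \<le> dist (\<mu> r) (\<mu> t) + \<epsilon>"
proof -
  have sub: "eps_geodesic X \<epsilon> \<mu> r t"
    using eps_geodesic_subsegment[OF geo] assms by simp
  have "ennreal (dist (\<mu> r) (\<mu> s) + dist (\<mu> s) (\<mu> t))
      = ennreal (dist (\<mu> r) (\<mu> s)) + ennreal (dist (\<mu> s) (\<mu> t))"
    by simp
  also have "\<dots> \<le> curve_length \<mu> r s + curve_length \<mu> s t"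
    using assms by (intro add_mono dist_le_curve_length) auto
  also have "\<dots> \<le> curve_length \<mu> r t"
    using assms by (intro curve_length_superadditive) auto
  also have "\<dots> \<le> ennreal (dist (\<mu> r) (\<mu> t) + \<epsilon>)"
    using sub unfolding eps_geodesic_def by blast
  finally show ?thesis
    using geo by (simp add: eps_geodesic_def del: ennreal_plus)
qed

text \<open>Legs of a tripod are long in terms of \<open>curve_length\<close>, whereas the estimates
  below need distances.\<close>

lemma eps_geodesic_curve_length_ge:
  assumes "eps_geodesic X \<epsilon> \<mu> a b" "ennreal R \<le> curve_length \<mu> a b"
  shows "R - \<epsilon> \<le> dist (\<mu> a) (\<mu> b)"
proof -
  have "ennreal R \<le> ennreal (dist (\<mu> a) (\<mu> b) + \<epsilon>)"
    using assms unfolding eps_geodesic_def by (meson order_trans)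
  then show ?thesis
    using assms(1) by (simp add: eps_geodesic_def del: ennreal_plus)
qed

section \<open>Signed distance as a coordinate along an almost geodesic\<close>

definition signed_dist :: "(real \<Rightarrow> 'a::metric_space) \<Rightarrow> real \<Rightarrow> real \<Rightarrow> real" where
  "signed_dist \<mu> r t = (if r \<le> t then dist (\<mu> r) (\<mu> t) else - dist (\<mu> r) (\<mu> t))"

lemma abs_signed_dist [simp]: "\<bar>signed_dist \<mu> r t\<bar> = dist (\<mu> r) (\<mu> t)"
  by (simp add: signed_dist_def)

lemma continuous_on_signed_dist:
  assumes "continuous_on {a..b} \<mu>"
    and f: "continuous_on S f" "f ` S \<subseteq> {a..b}"
    and g: "continuous_on S g" "g ` S \<subseteq> {a..b}"
  shows "continuous_on S (\<lambda>x. signed_dist \<mu> (f x) (g x))"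
proof -
  \<comment> \<open>This form has no case distinction, so continuity follows from that of
    \<open>max\<close>.\<close>
  have eq: "signed_dist \<mu> r t = dist (\<mu> r) (\<mu> (max r t)) - dist (\<mu> t) (\<mu> (max r t))" for r t
    by (auto simp: signed_dist_def max_def dist_commute)
  have \<mu>: "continuous_on S (\<lambda>x. \<mu> (h x))" if "continuous_on S h" "h ` S \<subseteq> {a..b}" for h
    using continuous_on_compose2[OF assms(1) that] .
  have max: "continuous_on S (\<lambda>x. max (f x) (g x))" "(\<lambda>x. max (f x) (g x)) ` S \<subseteq> {a..b}"
    using f g by (auto intro: continuous_on_max simp: image_subset_iff le_max_iff_disj)
  show ?thesis
    unfolding eq by (intro continuous_on_diff continuous_on_dist \<mu> f g max)
qed

text \<open>By antisymmetry this is, up to sign, the cyclic sum over \<open>r\<close>,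
  \<open>s\<close>, \<open>t\<close>. Permuting the points changes at most its sign, so almost
  additivity for ordered points suffices.\<close>

lemma eps_geodesic_signed_dist:
  assumes geo: "eps_geodesic X \<epsilon> \<mu> a b" and "r \<in> {a..b}" "s \<in> {a..b}" "t \<in> {a..b}"
  shows "\<bar>signed_dist \<mu> r t - (signed_dist \<mu> s t - signed_dist \<mu> s r)\<bar> \<le> \<epsilon>"
proof -
  let ?d = "signed_dist \<mu>"
  have anti: "?d u v = - ?d v u" for u v
    by (auto simp: signed_dist_def dist_commute)
  have le: "\<bar>?d r s + ?d s t + ?d t r\<bar> \<le> \<epsilon>"
    if "r \<le> s" "s \<le> t" "r \<in> {a..b}" "t \<in> {a..b}" for r s t
  proof -
    have "?d r s = dist (\<mu> r) (\<mu> s)" "?d s t = dist (\<mu> s) (\<mu> t)" "?d r t = dist (\<mu> r) (\<mu> t)"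
      using that by (auto simp: signed_dist_def)
    then show ?thesis
      using eps_geodesic_dist_add_le[OF geo, of r s t] dist_triangle[of "\<mu> r" "\<mu> t" "\<mu> s"] that
      by (simp add: abs_le_iff anti[of t r])
  qed
  note signs = anti[of s r] anti[of t r] anti[of t s]
  consider "r \<le> s" "s \<le> t" | "r \<le> t" "t \<le> s" | "s \<le> r" "r \<le> t" | "s \<le> t" "t \<le> r"
    | "t \<le> r" "r \<le> s" | "t \<le> s" "s \<le> r" by linarith
  then show ?thesis
  proof cases
    case 1 from le[OF this] show ?thesis using assms(2-4) signs by linarith
  next
    case 2 from le[OF this] show ?thesis using assms(2-4) signs by linarith
  next
    case 3 from le[OF this] show ?thesis using assms(2-4) signs by linarith
  next
    case 4 from le[OF this] show ?thesis using assms(2-4) signs by linarith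
  next
    case 5 from le[OF this] show ?thesis using assms(2-4) signs by linarith
  next
    case 6 from le[OF this] show ?thesis using assms(2-4) signs by linarith
  qed
qed

section \<open>Triangles on a tripod\<close>

text \<open>A point of \<open>\<mu>\<close> much closer to \<open>\<gamma> u\<close> than
  \<open>p\<close> would be too close to \<open>z\<close>, by way of \<open>\<gamma> u\<close>. One
  \<open>\<epsilon>\<close> is lost along \<open>\<gamma>\<close>, the other in the choice of
  \<open>p\<close>.\<close>

lemma tripod_dist_center_le:
  assumes tri: "tripod X \<epsilon> x y z p \<mu> a s b \<gamma> c d" and t: "t \<in> {a..b}" and u: "u \<in> {c..d}"
  shows "dist p (\<gamma> u) \<le> dist (\<mu> t) (\<gamma> u) + 2 * \<epsilon>"
proof -
  have \<gamma>: "eps_geodesic X \<epsilon> \<gamma> c d" "\<gamma> c = z" "\<gamma> d = p"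
    using tri by (simp_all add: tripod_def)
  have "dist z (\<gamma> u) + dist (\<gamma> u) p \<le> dist z p + \<epsilon>"
    using eps_geodesic_dist_add_le[OF \<gamma>(1), of c u d] \<gamma>(2,3) u by simp
  moreover have "dist z p \<le> dist z (\<mu> t) + \<epsilon>"
    using tri t by (simp add: tripod_def)
  moreover have "dist z (\<mu> t) \<le> dist z (\<gamma> u) + dist (\<gamma> u) (\<mu> t)"
    by (rule dist_triangle)
  ultimately show ?thesis
    by (simp add: dist_commute)
qed

text \<open>The slack \<open>\<eta>\<close> in the triangle inequalities absorbs all errors. In the
  proof, \<open>t\<close>, \<open>u\<close>, \<open>v\<close> are the parameters of P, Q, Z.\<close>

lemma triangle_in_K3_of_tripod:
  assumes tripod: "R_eps_tripod X R \<epsilon> x y z p \<mu> l s r \<gamma> m n"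
    and \<eta>: "0 < \<eta>" "\<eta> \<le> b + c - a" "\<eta> \<le> a + c - b" "\<eta> \<le> a + b - c"
    and \<epsilon>: "8 * \<epsilon> \<le> \<eta>" and R: "10 * (a + b + c) \<le> R"
  shows "(a, b, c) \<in> K3 X"
proof -
  \<comment> \<open>P stays within about \<open>\<rho>\<close> of the center: far compared with the
    sides, yet leaving room on \<open>\<mu>\<close> for Q ahead of P. Z counts as near the center
    within \<open>\<zeta>\<close>. With Z at the center, \<open>K * (\<eta> / 2)\<close> bounds
    \<open>H\<close> up to \<open>\<bar>F t u\<bar>\<close>.\<close>
  define \<rho> where "\<rho> = 8 * (a + b + c)"
  define \<zeta> where "\<zeta> = \<eta> / 8"
  define K where "K = 2 * (2 * \<rho> + 4 * a) / \<eta>"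
  have geo: "eps_geodesic X \<epsilon> \<mu> l r" "eps_geodesic X \<epsilon> \<gamma> m n"
    and ends: "\<mu> l = x" "\<mu> r = y" "\<mu> s = p" "\<gamma> m = z" "\<gamma> n = p"
    and s: "l \<le> s" "s \<le> r"
    using tripod by (auto simp: R_eps_tripod_def tripod_def)
  have tri: "tripod X \<epsilon> x y z p \<mu> l s r \<gamma> m n"
    using tripod by (simp add: R_eps_tripod_def)
  have \<mu>: "continuous_on {l..r} \<mu>" "\<mu> ` {l..r} \<subseteq> X" "l \<le> r"
    and \<gamma>: "continuous_on {m..n} \<gamma>" "\<gamma> ` {m..n} \<subseteq> X" "m \<le> n" and "0 \<le> \<epsilon>"
    using geo by (auto simp: eps_geodesic_def curve_in_def)
  have legs: "R - \<epsilon> \<le> dist x p" "R - \<epsilon> \<le> dist p y" "R - \<epsilon> \<le> dist z p"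
    using tripod s ends
      eps_geodesic_curve_length_ge[OF eps_geodesic_subsegment[OF geo(1), of l s], of R]
      eps_geodesic_curve_length_ge[OF eps_geodesic_subsegment[OF geo(1), of s r], of R]
      eps_geodesic_curve_length_ge[OF geo(2), of R]
    by (auto simp: R_eps_tripod_def)
  \<comment> \<open>Adding two of the slacks gives twice a side.\<close>
  have pos: "0 < \<zeta>" "\<eta> \<le> a" "0 < b" "0 < c" "0 < \<rho>" "0 \<le> K"
    using \<eta> by (auto simp: \<zeta>_def \<rho>_def K_def)

  have "\<exists>t\<ge>l. t \<le> s \<and> dist (\<mu> t) p = \<rho>"
    using legs(1) s ends R pos \<eta> \<epsilon>
    by (intro IVT2' continuous_intros continuous_on_subset[OF \<mu>(1)]) (auto simp: \<rho>_def)
  then obtain l' where l': "l \<le> l'" "l' \<le> s" "dist (\<mu> l') p = \<rho>" by blast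
  have "\<exists>t\<ge>s. t \<le> r \<and> dist (\<mu> t) p = \<rho>"
    using legs(2) s ends R pos \<eta> \<epsilon>
    by (intro IVT' continuous_intros continuous_on_subset[OF \<mu>(1)]) (auto simp: \<rho>_def dist_commute)
  then obtain r' where r': "s \<le> r'" "r' \<le> r" "dist (\<mu> r') p = \<rho>" by blast
  have "l' \<noteq> s" "s \<noteq> r'"
    using l'(3) r'(3) ends pos by auto
  then have "l' < r'" "l' < s" using l' r' by auto
  \<comment> \<open>An approximate coordinate on \<open>\<mu>\<close> with origin at the
    center.\<close>
  define \<kappa> where "\<kappa> t = signed_dist \<mu> s t" for t
  have abs_\<kappa>: "\<bar>\<kappa> t\<bar> = dist (\<mu> t) p" for t
    by (simp add: \<kappa>_def ends dist_commute)
  have \<kappa>_ends: "\<kappa> l' = - \<rho>" "\<kappa> r' = \<rho>"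
    using l' r' ends \<open>l' < s\<close> by (auto simp: \<kappa>_def signed_dist_def dist_commute)
  have \<kappa>_le: "\<bar>\<kappa> t\<bar> \<le> \<rho> + \<epsilon>" if "t \<in> {l'..r'}" for t
    using that l' r' ends eps_geodesic_dist_add_le[OF geo(1), of l' t s]
      eps_geodesic_dist_add_le[OF geo(1), of s t r']
      zero_le_dist[of "\<mu> l'" "\<mu> t"] zero_le_dist[of "\<mu> r'" "\<mu> t"]
    unfolding abs_\<kappa> by (cases "t \<le> s") (auto simp: dist_commute simp del: zero_le_dist)

  \<comment> \<open>The difference and the sum of the two distances to Z turn the half strip into a
    product, \<open>[-a, a]\<close> times \<open>[a, \<infinity>)\<close>.\<close>
  define F where "F t u = signed_dist \<mu> t u - a" for t u
  define G where "G t u v = dist (\<mu> u) (\<gamma> v) - dist (\<gamma> v) (\<mu> t) - (b - c)" for t u v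
  define H where "H t u v = dist (\<mu> u) (\<gamma> v) + dist (\<gamma> v) (\<mu> t) - (b + c)" for t u v
  \<comment> \<open>The signs of \<open>F\<close>, \<open>G\<close>, \<open>H\<close> on the faces are not yet right: \<open>H > 0\<close> far out on the face where
    the point of \<open>\<gamma>\<close> is the center, and \<open>G\<close> is uncontrolled on the faces \<open>t = l'\<close>, \<open>t = r'\<close> when the
    point of \<open>\<gamma>\<close> is far from the center. The corrections below repair the signs without creating zeros,
    because \<open>F = H' = 0\<close> kills the correction in \<open>G'\<close>, and then \<open>F = G = 0\<close> kills the one in \<open>H'\<close>.\<close>
  define \<phi> where "\<phi> v = (1 + K) * max 0 (1 - dist p (\<gamma> v) / \<zeta>)" for v
  define \<theta> where "\<theta> t = (2 * t - l' - r') / (r' - l')" for t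
  define H' where "H' t u v = H t u v - \<phi> v * (\<bar>G t u v\<bar> + \<bar>F t u\<bar>)" for t u v
  define G' where "G' t u v = G t u v + \<theta> t * (max 0 (H' t u v) + \<bar>F t u\<bar>)" for t u v
  have \<theta>: "\<theta> l' = -1" "\<theta> r' = 1"
    using \<open>l' < r'\<close> by (auto simp: \<theta>_def field_simps)
  have \<phi>_zero: "\<phi> v = 0" if "\<zeta> \<le> dist p (\<gamma> v)" for v
    using that pos by (simp add: \<phi>_def max_def)

  let ?B = "{l'..r'} \<times> {l..r} \<times> {m..n}"
  have cont_\<mu>: "continuous_on ?B (\<lambda>q. \<mu> (f q))"
    if "continuous_on ?B f" "f ` ?B \<subseteq> {l..r}" for f
    using continuous_on_compose2[OF \<mu>(1) that] .
  have cont_\<gamma>: "continuous_on ?B (\<lambda>q. \<gamma> (f q))"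
    if "continuous_on ?B f" "f ` ?B \<subseteq> {m..n}" for f
    using continuous_on_compose2[OF \<gamma>(1) that] .
  have proj: "fst ` ?B \<subseteq> {l..r}" "(\<lambda>q. fst (snd q)) ` ?B \<subseteq> {l..r}" "(\<lambda>q. snd (snd q)) ` ?B \<subseteq> {m..n}"
    using l' r' by auto
  have cont_F: "continuous_on ?B (\<lambda>(t, u, v). F t u)"
    unfolding F_def case_prod_unfold using proj
    by (intro continuous_on_diff continuous_on_signed_dist[OF \<mu>(1)] continuous_intros)
  have cont_G: "continuous_on ?B (\<lambda>(t, u, v). G t u v)"
    and cont_H: "continuous_on ?B (\<lambda>(t, u, v). H t u v)"
    unfolding G_def H_def case_prod_unfold using proj
    by (intro continuous_intros cont_\<mu> cont_\<gamma>; simp)+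
  have "continuous_on ?B (\<lambda>(t, u, v). \<phi> v)"
    unfolding \<phi>_def case_prod_unfold using proj pos
    by (intro continuous_intros cont_\<gamma>) auto
  then have cont_H': "continuous_on ?B (\<lambda>(t, u, v). H' t u v)"
    using cont_F cont_G cont_H unfolding H'_def case_prod_unfold
    by (intro continuous_intros)
  then have cont_G': "continuous_on ?B (\<lambda>(t, u, v). G' t u v)"
    using cont_F cont_G \<open>l' < r'\<close> unfolding G'_def \<theta>_def case_prod_unfold
    by (intro continuous_intros) auto

  have \<kappa>_diff: "\<bar>\<kappa> u - \<kappa> t - a - F t u\<bar> \<le> \<epsilon>" if "t \<in> {l'..r'}" "u \<in> {l..r}" for t u
    using eps_geodesic_signed_dist[OF geo(1), of t s u] that l' r' s
    by (auto simp: F_def \<kappa>_def)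
  have near: "\<bar>dist (\<mu> t) (\<gamma> v) - \<bar>\<kappa> t\<bar>\<bar> \<le> dist p (\<gamma> v)" for t v
    using dist_triangle[of "\<mu> t" "\<gamma> v" p] dist_triangle[of "\<mu> t" p "\<gamma> v"]
    unfolding abs_\<kappa> by (auto simp: dist_commute)
  have far: "dist p (\<gamma> v) - 2 * \<epsilon> \<le> dist (\<mu> t) (\<gamma> v)" if "t \<in> {l..r}" "v \<in> {m..n}" for t v
    using tripod_dist_center_le[OF tri that] by simp
  have G_le: "\<bar>G t u v\<bar> \<le> \<bar>F t u\<bar> + a + \<bar>b - c\<bar>" for t u v
  proof -
    have "\<bar>dist (\<mu> u) (\<gamma> v) - dist (\<gamma> v) (\<mu> t)\<bar> \<le> dist (\<mu> t) (\<mu> u)"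
      using dist_triangle[of "\<mu> u" "\<gamma> v" "\<mu> t"] dist_triangle[of "\<mu> t" "\<gamma> v" "\<mu> u"]
      by (auto simp: dist_commute)
    also have "\<dots> = \<bar>F t u + a\<bar>"
      unfolding F_def by (simp flip: abs_signed_dist)
    finally show ?thesis
      using pos \<eta> unfolding G_def by linarith
  qed

  have face_F: "F t l \<le> 0 \<and> 0 \<le> F t r" if "t \<in> {l'..r'}" for t
  proof -
    have "signed_dist \<mu> t l \<le> 0"
      using that l' by (cases "t = l") (auto simp: signed_dist_def)
    moreover have "\<kappa> r = dist p y"
      using s ends by (simp add: \<kappa>_def signed_dist_def)
    ultimately show ?thesis
      using that \<kappa>_diff[OF that, of r] \<kappa>_le[OF that] legs(2) R \<epsilon> \<eta> pos \<mu>(3)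
      unfolding F_def \<rho>_def by auto
  qed
  have face_G': "G' l' u v \<le> 0 \<and> 0 \<le> G' r' u v" if u: "u \<in> {l..r}" and v: "v \<in> {m..n}" for u v
  proof (cases "dist p (\<gamma> v) \<le> \<zeta>")
    case True
    \<comment> \<open>If \<open>F\<close> vanishes, P and Q lie on the same side of the center, so
      the difference of their distances to Z is about \<open>-a\<close> at \<open>l'\<close> and
      \<open>a\<close> at \<open>r'\<close>. This misses \<open>b - c\<close> by
      \<open>\<eta>\<close>, up to an error of \<open>2 * \<zeta> + \<epsilon>\<close>.\<close>
    have "G l' u v \<le> \<bar>F l' u\<bar>" "- \<bar>F r' u\<bar> \<le> G r' u v"
      using True near[of l' v] near[of r' v] near[of u v] \<kappa>_ends pos \<epsilon> \<eta> u \<open>l' < r'\<close>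
        \<kappa>_diff[of l' u] \<kappa>_diff[of r' u]
      unfolding G_def \<zeta>_def \<rho>_def by (auto simp: dist_commute)
    then show ?thesis
      unfolding G'_def \<theta> by auto
  next
    case False
    \<comment> \<open>Averaging \<open>near\<close> and \<open>far\<close> puts Z at distance at
      least \<open>\<rho> / 2 - \<epsilon>\<close> from P, so \<open>H\<close> exceeds the bound
      that \<open>G_le\<close> adds to \<open>\<bar>F t u\<bar>\<close>.\<close>
    have "a + \<bar>b - c\<bar> \<le> H t u v" if "t \<in> {l', r'}" for t
    proof -
      have "t \<in> {l..r}" "\<bar>\<kappa> t\<bar> = \<rho>"
        using that l' r' \<kappa>_ends pos by auto
      then show ?thesis
        using near[of t v] far[of t v] \<epsilon> \<eta> pos v zero_le_dist[of "\<mu> u" "\<gamma> v"]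
        unfolding H_def \<rho>_def by (auto simp: dist_commute simp del: zero_le_dist)
    qed
    then have "a + \<bar>b - c\<bar> \<le> H' l' u v" "a + \<bar>b - c\<bar> \<le> H' r' u v"
      using False \<phi>_zero by (auto simp: H'_def)
    then show ?thesis
      using G_le[of l' u v] G_le[of r' u v]
        max.cobounded2[of "H' l' u v" 0] max.cobounded2[of "H' r' u v" 0]
      unfolding G'_def \<theta> by argo
  qed
  have face_H': "H' t u n \<le> 0 \<and> 0 \<le> H' t u m" if t: "t \<in> {l'..r'}" and u: "u \<in> {l..r}" for t u
  proof
    define w where "w = \<bar>G t u n\<bar> + \<bar>F t u\<bar>"
    have GH: "G t u n = \<bar>\<kappa> u\<bar> - \<bar>\<kappa> t\<bar> - (b - c)" "H t u n = \<bar>\<kappa> u\<bar> + \<bar>\<kappa> t\<bar> - (b + c)"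
      by (simp_all add: G_def H_def ends abs_\<kappa> dist_commute)
    \<comment> \<open>With P before and Q after the center, their distances to it sum to about
      \<open>a\<close>, which is below \<open>b + c\<close>. Otherwise the difference of these
      distances is at least \<open>a\<close> or at most \<open>-a\<close>, up to \<open>F\<close>
      and \<open>\<epsilon>\<close>, so \<open>G\<close> and \<open>F\<close> cannot both be small,
      and \<open>K * w\<close> dominates \<open>H\<close>.\<close>
    have "H t u n \<le> w + K * w"
    proof (cases "\<kappa> t \<le> 0 \<and> 0 \<le> \<kappa> u")
      case True
      then have "H t u n \<le> \<bar>F t u\<bar>"
        using GH \<kappa>_diff[OF t u] \<epsilon> \<eta> by auto
      moreover have "0 \<le> K * w"
        using pos by (simp add: w_def)
      ultimately show ?thesis
        by (simp add: w_def)
    next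
      case False
      then consider "0 < \<kappa> t" | "\<kappa> u < 0" by linarith
      then have "\<eta> - \<epsilon> \<le> w"
      proof cases
        case 1
        then have "\<eta> - \<epsilon> - \<bar>F t u\<bar> \<le> G t u n"
          using GH(1) \<kappa>_diff[OF t u] \<eta> by linarith
        then show ?thesis
          unfolding w_def by linarith
      next
        case 2
        then have "\<eta> - \<epsilon> - \<bar>F t u\<bar> \<le> - G t u n"
          using GH(1) \<kappa>_diff[OF t u] \<eta> by linarith
        then show ?thesis
          unfolding w_def by linarith
      qed
      then have "\<eta> / 2 \<le> w"
        using \<epsilon> \<eta> by simp
      then have "K * (\<eta> / 2) \<le> K * w"
        using pos by (intro mult_left_mono)
      moreover have "K * (\<eta> / 2) = 2 * \<rho> + 4 * a"
        using \<eta> by (simp add: K_def)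
      moreover have "H t u n \<le> 2 * \<rho> + 4 * a + \<bar>F t u\<bar>"
        using GH(2) \<kappa>_diff[OF t u] \<kappa>_le[OF t] \<epsilon> \<eta> pos by linarith
      ultimately show ?thesis
        by (simp add: w_def)
    qed
    then show "H' t u n \<le> 0"
      by (simp add: H'_def \<phi>_def ends w_def algebra_simps)
    \<comment> \<open>Now Z is the vertex \<open>z\<close>, far from the center and hence from all
      of \<open>\<mu>\<close>.\<close>
    have "\<phi> m = 0"
      using legs(3) R \<epsilon> \<eta> pos
      by (intro \<phi>_zero) (auto simp: ends \<zeta>_def dist_commute)
    moreover have "0 \<le> H t u m"
      using far[of t m] far[of u m] t u l' r' \<gamma>(3) legs(3) R \<epsilon> \<eta> pos
      unfolding H_def by (auto simp: ends dist_commute)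
    ultimately show "0 \<le> H' t u m"
      by (simp add: H'_def)
  qed

  obtain t u v where tuv: "t \<in> {l'..r'}" "u \<in> {l..r}" "v \<in> {m..n}"
    and zero: "G' t u v = 0" "F t u = 0" "- H' t u v = 0"
  \<comment> \<open>\<open>H'\<close> is negated because \<open>\<gamma>\<close> runs from
    \<open>z\<close> to the center, so its nonnegative face is the lower one.\<close>
  proof (rule poincare_miranda_3[of l' r' l r m n G' "\<lambda>t u v. F t u" "\<lambda>t u v. - H' t u v"])
    show "continuous_on ?B (\<lambda>(t, u, v). - H' t u v)"
      using continuous_on_minus[OF cont_H'] by (simp add: case_prod_unfold)
  qed (use \<open>l' < r'\<close> \<mu>(3) \<gamma>(3) cont_F cont_G' face_F face_G' face_H' in auto)
  then have "G t u v = 0" "H t u v = 0"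
    by (simp_all add: G'_def H'_def)
  then have "dist (\<mu> u) (\<gamma> v) = b" "dist (\<gamma> v) (\<mu> t) = c"
    by (auto simp: G_def H_def)
  moreover have "dist (\<mu> t) (\<mu> u) = a"
    using zero(2) pos \<eta> abs_signed_dist[of \<mu> t u] by (auto simp: F_def)
  moreover have "\<mu> t \<in> X" "\<mu> u \<in> X" "\<gamma> v \<in> X"
    using tuv l' r' \<mu>(2) \<gamma>(2) by (auto simp: image_subset_iff)
  ultimately show ?thesis
    unfolding K3_def by blast
qed

section \<open>Nondegenerate triangles and the conclusion\<close>

text \<open>Each side can be lengthened by \<open>e / 2\<close> inside \<open>K3 X\<close>, where
  the weak triangle inequalities hold.\<close>

lemma interior_K3_strict_triangle:
  assumes "(a, b, c) \<in> interior (K3 X)"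
  shows "a < b + c" "b < a + c" "c < a + b"
proof -
  obtain e where e: "0 < e" "ball (a, b, c) e \<subseteq> K3 X"
    using assms by (auto simp: mem_interior)
  have "(a + e / 2, b, c) \<in> K3 X" "(a, b + e / 2, c) \<in> K3 X" "(a, b, c + e / 2) \<in> K3 X"
    using e by (auto intro!: subsetD[OF e(2)] simp: dist_Pair_Pair dist_real_def)
  moreover have "a \<le> b + c \<and> b \<le> a + c \<and> c \<le> a + b" if abc: "(a, b, c) \<in> K3 X" for a b c
  proof -
    obtain x y z where "x \<in> X" "dist x y = a" "dist y z = b" "dist z x = c"
      using abc unfolding K3_def by blast
    then show ?thesis
      using dist_triangle[of x y z] dist_triangle[of y z x] dist_triangle[of z x y]
      by (simp add: dist_commute)
  qed
  ultimately show "a < b + c" "b < a + c" "c < a + b"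
    using e(1) by fastforce+
qed

theorem theorem3:
  fixes X :: "'a::metric_space set"
  assumes "path_metric_space X"
    and "uncompressed X"
  shows "interior (K3 (UNIV :: (real ^ 2) set)) \<subseteq> K3 X"
proof clarify
  fix a b c assume abc: "(a, b, c) \<in> interior (K3 (UNIV :: (real ^ 2) set))"
  define \<eta> where "\<eta> = Min {b + c - a, a + c - b, a + b - c}"
  have \<eta>: "0 < \<eta>" "\<eta> \<le> b + c - a" "\<eta> \<le> a + c - b" "\<eta> \<le> a + b - c"
    using interior_K3_strict_triangle[OF abc] by (auto simp: \<eta>_def)
  \<comment> \<open>The thresholds are those under which a single tripod carries the required
    triangle.\<close>
  have "\<not> compressed X (10 * (a + b + c)) (\<eta> / 8)"
    using assms(2) \<eta>(1) by (simp add: uncompressed_def)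
  then obtain x y z p \<mu> l s r \<gamma> m n
    where "R_eps_tripod X (10 * (a + b + c)) (\<eta> / 8) x y z p \<mu> l s r \<gamma> m n"
    by (auto simp: compressed_def)
  from triangle_in_K3_of_tripod[OF this \<eta>] show "(a, b, c) \<in> K3 X"
    by simp
qed

end
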